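(* For $\ell\ge 1$, let $c(\mathcal C^\circ_\ell)$ be the central arrangement in $\mathbb C^{\ell+1}$ (coordinates $x_0,x_1,\dots,x_\ell$) consisting of the hyperplanes $\{x_0=0\}$, $\{x_i-x_j+x_0=0\}$ and $\{x_i-x_j-x_0=0\}$ for $1\le i<j\le\ell$ (the cone of the semiorder arrangement). Then its Falk invariant is $\phi_3(c(\mathcal C^\circ_\ell))=\ell(\ell-1)$.
   Context: Falk invariant: for a central arrangement with hyperplanes $H_0,\dots,H_n$, $H_i=\alpha_i^{-1}(0)$, let $E$ be the exterior algebra over $\mathbb C$ on $e_0,\dots,e_n$ with degree-$p$ part $E^p$, and $\partial$ the degree $-1$ derivation with $\partial e_i=1$. A subset $S$ is dependent if $\{\alpha_i:i\in S\}$ is linearly dependent. The Orlik–Solomon ideal $I$ is generated by $\partial e_S$ for $S$ dependent ($e_S$ the ordered wedge of $e_i$, $i\in S$), $I^p=I\cap E^p$, and $\phi_3=\dim\ker(E^1\otimes I^2\to E^3,\ a\otimes b\mapsto a\wedge b)$. *)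

theory Defs
  imports Complex_Main "HOL-Library.Function_Algebras"
begin

definition cscale :: "complex \<Rightarrow> ('a \<Rightarrow> complex) \<Rightarrow> 'a \<Rightarrow> complex" where
  "cscale c f = (\<lambda>x. c * f x)"

global_interpretation cfun: vector_space "cscale :: complex \<Rightarrow> ('a \<Rightarrow> complex) \<Rightarrow> 'a \<Rightarrow> complex"
  by unfold_locales (auto simp: cscale_def fun_eq_iff algebra_simps)

section \<open>Central arrangements\<close>

text \<open>The space of \<open>d\<close>-tuples of complex numbers is modelled by the functions vanishing from
  index \<open>d\<close> on; a linear form on it is given by its vector of coefficients.\<close>

definition coord_space :: "nat \<Rightarrow> (nat \<Rightarrow> complex) set" where
  "coord_space d = {x. \<forall>k\<ge>d. x k = 0}"

definition hyperplane :: "nat \<Rightarrow> (nat \<Rightarrow> complex) \<Rightarrow> (nat \<Rightarrow> complex) set" where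
  "hyperplane d a = {x \<in> coord_space d. (\<Sum>k<d. a k * x k) = 0}"

definition defining_forms ::
  "nat \<Rightarrow> nat \<Rightarrow> (nat \<Rightarrow> nat \<Rightarrow> complex) \<Rightarrow> (nat \<Rightarrow> complex) set set \<Rightarrow> bool" where
  "defining_forms d n \<alpha> \<A> \<longleftrightarrow>
     (\<forall>i\<le>n. \<alpha> i \<in> coord_space d \<and> \<alpha> i \<noteq> 0) \<and>
     bij_betw (\<lambda>i. hyperplane d (\<alpha> i)) {..n} \<A>"

definition semiorder_cone :: "nat \<Rightarrow> (nat \<Rightarrow> complex) set set" where
  "semiorder_cone l =
     {{x \<in> coord_space (l + 1). x 0 = 0}} \<union>
     {{x \<in> coord_space (l + 1). x i - x j + x 0 = 0} |i j. 1 \<le> i \<and> i < j \<and> j \<le> l} \<union>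
     {{x \<in> coord_space (l + 1). x i - x j - x 0 = 0} |i j. 1 \<le> i \<and> i < j \<and> j \<le> l}"

lemma semiorder_cone_hyperplane:
  assumes "H \<in> semiorder_cone l"
  shows "\<exists>a. a \<in> coord_space (l + 1) \<and> a \<noteq> 0 \<and> H = hyperplane (l + 1) a"
proof -
  have *: "\<exists>a. a \<in> coord_space (l + 1) \<and> a \<noteq> 0 \<and>
      {x \<in> coord_space (l + 1). x i - x j + c * x 0 = 0} = hyperplane (l + 1) a"
    if ij: "1 \<le> i" "i < j" "j \<le> l" for i j and c :: complex
  proof -
    define a :: "nat \<Rightarrow> complex" where
      "a = (\<lambda>k. (if k = i then 1 else 0) + (if k = j then - 1 else 0) + (if k = 0 then c else 0))"
    have "(\<Sum>k<l + 1. a k * x k) = x i - x j + c * x 0" for x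
    proof -
      have "(\<Sum>k<l + 1. a k * x k) = (\<Sum>k<l + 1. if k = i then x i else 0)
          + (\<Sum>k<l + 1. if k = j then - x j else 0) + (\<Sum>k<l + 1. if k = 0 then c * x 0 else 0)"
        unfolding sum.distrib[symmetric]
        by (rule sum.cong) (auto simp: a_def algebra_simps)
      also have "\<dots> = x i - x j + c * x 0" using ij by (simp add: less_Suc_eq_le del: sum.lessThan_Suc)
      finally show ?thesis .
    qed
    moreover have "a i = 1" using ij by (auto simp: a_def)
    then have "a \<noteq> 0" by auto
    moreover have "a \<in> coord_space (l + 1)" using ij by (auto simp: a_def coord_space_def)
    ultimately show ?thesis unfolding hyperplane_def by (intro exI[of _ a]) simp
  qed
  define e :: "nat \<Rightarrow> complex" where "e = (\<lambda>k. if k = 0 then 1 else 0)"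
  have "(\<Sum>k<l + 1. e k * x k) = x 0" for x
  proof -
    have "(\<Sum>k<l + 1. e k * x k) = (\<Sum>k<l + 1. if k = 0 then x 0 else 0)"
      by (rule sum.cong) (auto simp: e_def)
    then show ?thesis by (simp del: sum.lessThan_Suc)
  qed
  moreover have "e 0 = 1" by (simp add: e_def)
  then have "e \<noteq> 0" by auto
  moreover have "e \<in> coord_space (l + 1)" by (auto simp: e_def coord_space_def)
  ultimately have "\<exists>a. a \<in> coord_space (l + 1) \<and> a \<noteq> 0 \<and>
      {x \<in> coord_space (l + 1). x 0 = 0} = hyperplane (l + 1) a"
    unfolding hyperplane_def by (intro exI[of _ e]) simp
  then show ?thesis
    using assms *[of _ _ 1] *[of _ _ "- 1"] unfolding semiorder_cone_def by auto
qed

lemma defining_forms_semiorder_cone_exist: "\<exists>n \<alpha>. defining_forms (l + 1) n \<alpha> (semiorder_cone l)"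
proof -
  let ?A = "semiorder_cone l"
  have "?A \<subseteq> {{x \<in> coord_space (l + 1). x 0 = 0}} \<union>
      (\<lambda>(i, j). {x \<in> coord_space (l + 1). x i - x j + x 0 = 0}) ` ({..l} \<times> {..l}) \<union>
      (\<lambda>(i, j). {x \<in> coord_space (l + 1). x i - x j - x 0 = 0}) ` ({..l} \<times> {..l})"
    unfolding semiorder_cone_def by fastforce
  then have fin: "finite ?A" by (rule finite_subset) auto
  moreover have "?A \<noteq> {}" by (auto simp: semiorder_cone_def)
  ultimately obtain n where n: "card ?A = Suc n" by (metis card_0_eq not0_implies_Suc)
  have "\<exists>h. bij_betw h {..n} ?A"
    using ex_bij_betw_nat_finite[OF fin] by (simp add: n atLeast0LessThan lessThan_Suc_atMost)
  then obtain h where h: "bij_betw h {..n} ?A" ..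
  have "\<forall>i\<in>{..n}. \<exists>a. a \<in> coord_space (l + 1) \<and> a \<noteq> 0 \<and> h i = hyperplane (l + 1) a"
    using h semiorder_cone_hyperplane by (meson bij_betwE)
  then obtain \<alpha> where \<alpha>: "\<forall>i\<in>{..n}. \<alpha> i \<in> coord_space (l + 1) \<and> \<alpha> i \<noteq> 0 \<and>
      h i = hyperplane (l + 1) (\<alpha> i)"
    by metis
  have "bij_betw (\<lambda>i. hyperplane (l + 1) (\<alpha> i)) {..n} ?A"
    using h by (rule bij_betw_cong[THEN iffD1, rotated]) (use \<alpha> in auto)
  then have "defining_forms (l + 1) n \<alpha> ?A"
    using \<alpha> by (auto simp: defining_forms_def)
  then show ?thesis by blast
qed

section \<open>The exterior algebra\<close>

text \<open>An element of the exterior algebra on \<open>e\<^sub>0, \<dots>, e\<^sub>n\<close> is given by its coefficients in the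
  basis of the ordered wedges \<open>e\<^sub>S\<close>, where \<open>S\<close> ranges over the subsets of \<open>{..n}\<close>.\<close>

type_synonym ext = "nat set \<Rightarrow> complex"

definition ext_alg :: "nat \<Rightarrow> ext set" where
  "ext_alg n = {a. \<forall>S. a S \<noteq> 0 \<longrightarrow> S \<subseteq> {..n}}"

definition ext_deg :: "nat \<Rightarrow> nat \<Rightarrow> ext set" where
  "ext_deg n p = {a \<in> ext_alg n. \<forall>S. a S \<noteq> 0 \<longrightarrow> card S = p}"

definition ext_basis :: "nat set \<Rightarrow> ext" where
  "ext_basis S = (\<lambda>T. if T = S then 1 else 0)"

text \<open>For disjoint \<open>S\<close> and \<open>T\<close>, this is the sign with \<open>e\<^sub>S \<and> e\<^sub>T = \<plusminus> e\<^bsub>S \<union> T\<^esub>\<close>.\<close>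

definition shuffle_sign :: "nat set \<Rightarrow> nat set \<Rightarrow> complex" where
  "shuffle_sign S T = (- 1) ^ card {(s, t). s \<in> S \<and> t \<in> T \<and> t < s}"

definition wedge :: "ext \<Rightarrow> ext \<Rightarrow> ext" where
  "wedge a b = (\<lambda>U. \<Sum>S\<in>Pow U. shuffle_sign S (U - S) * a S * b (U - S))"

text \<open>The derivation with \<open>\<partial> e\<^sub>i = 1\<close>, in coordinates: for \<open>S = {s\<^sub>0 < \<dots> < s\<^sub>p}\<close> it maps \<open>e\<^sub>S\<close> to the
  sum of the \<open>(- 1)\<^sup>k e\<^bsub>S - {s\<^sub>k}\<^esub>\<close>. It is determined by linearity, \<open>ext_diff_one\<close> and
  \<open>ext_diff_wedge_generator\<close> below.\<close>

definition ext_diff :: "nat \<Rightarrow> ext \<Rightarrow> ext" where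
  "ext_diff n a = (\<lambda>T. \<Sum>i\<in>{..n} - T. (- 1) ^ card {j \<in> T. j < i} * a (insert i T))"

lemma wedge_generator:
  assumes "finite U"
  shows "wedge (ext_basis {i}) b U =
    (if i \<in> U then (- 1) ^ card {j \<in> U. j < i} * b (U - {i}) else 0)"
proof -
  have *: "wedge (ext_basis {i}) b U =
      (\<Sum>S\<in>Pow U. if S = {i} then shuffle_sign {i} (U - {i}) * b (U - {i}) else 0)"
    unfolding wedge_def ext_basis_def by (intro sum.cong) auto
  have "{(s, t). s \<in> {i} \<and> t \<in> U - {i} \<and> t < s} = Pair i ` {j \<in> U. j < i}"
    by auto
  then have "shuffle_sign {i} (U - {i}) = (- 1) ^ card {j \<in> U. j < i}"
    by (simp add: shuffle_sign_def card_image inj_on_def)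
  then show ?thesis
    unfolding * using assms by simp
qed

lemma wedge_infinite: "infinite U \<Longrightarrow> wedge a b U = 0"
  by (simp add: wedge_def finite_Pow_iff)

lemma ext_basis_insert:
  assumes "finite S" and "\<And>j. j \<in> S \<Longrightarrow> i < j"
  shows "ext_basis (insert i S) = wedge (ext_basis {i}) (ext_basis S)"
proof
  fix U
  have "i \<notin> S" using assms(2) by blast
  show "ext_basis (insert i S) U = wedge (ext_basis {i}) (ext_basis S) U"
  proof (cases "finite U")
    case False
    then show ?thesis using assms(1) by (auto simp: wedge_infinite ext_basis_def)
  next
    case True
    have *: "{j \<in> insert i S. j < i} = {}" using assms(2) by fastforce
    show ?thesis
    proof (cases "U = insert i S")
      case True
      have "insert i S - {i} = S" using \<open>i \<notin> S\<close> by auto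
      then show ?thesis
        unfolding True wedge_generator[OF finite.insertI[OF assms(1)]] *
        by (simp add: ext_basis_def)
    next
      case False
      then have "i \<in> U \<Longrightarrow> U - {i} \<noteq> S" by auto
      then show ?thesis
        unfolding wedge_generator[OF \<open>finite U\<close>] using False by (simp add: ext_basis_def)
    qed
  qed
qed

lemma ext_diff_one: "ext_diff n (ext_basis {}) = 0"
  by (auto simp: ext_diff_def ext_basis_def fun_eq_iff)

lemma ext_diff_generator:
  assumes "i \<le> n"
  shows "ext_diff n (ext_basis {i}) = ext_basis {}"
proof
  fix T
  have "insert j T = {i} \<longleftrightarrow> j = i \<and> T = {}" if "j \<notin> T" for j
    using that by auto
  then have "ext_diff n (ext_basis {i}) T =
      (\<Sum>j\<in>{..n} - T. if j = i then (if T = {} then 1 else 0) else 0)"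
    unfolding ext_diff_def ext_basis_def by (intro sum.cong) auto
  then show "ext_diff n (ext_basis {i}) T = ext_basis {} T"
    using assms by (auto simp: ext_basis_def)
qed

lemma ext_diff_wedge_generator:
  assumes "i \<le> n" and "b \<in> ext_alg n"
  shows "ext_diff n (wedge (ext_basis {i}) b) = b - wedge (ext_basis {i}) (ext_diff n b)"
proof
  fix T
  show "ext_diff n (wedge (ext_basis {i}) b) T = (b - wedge (ext_basis {i}) (ext_diff n b)) T"
  proof (cases "finite T")
    case False
    then have "b T = 0" using assms(2) finite_subset[of T "{..n}"] by (auto simp: ext_alg_def)
    with False show ?thesis by (simp add: wedge_infinite ext_diff_def)
  next
    case fin: True
    show ?thesis
    proof (cases "i \<in> T")
      case False
      have "ext_diff n (wedge (ext_basis {i}) b) T = (\<Sum>j\<in>{..n} - T. if j = i then b T else 0)"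
        unfolding ext_diff_def
      proof (intro sum.cong refl)
        fix j assume "j \<in> {..n} - T"
        have "{k \<in> insert i T. k < i} = {k \<in> T. k < i}" by auto
        then show "(- 1) ^ card {k \<in> T. k < j} * wedge (ext_basis {i}) b (insert j T) =
            (if j = i then b T else 0)"
          using False fin by (auto simp: wedge_generator simp flip: power_add mult_2)
      qed
      then show ?thesis using False fin assms(1) by (simp add: wedge_generator)
    next
      case True
      define R where "R = T - {i}"
      have R: "T = insert i R" "i \<notin> R" "finite R" using True fin by (auto simp: R_def)
      let ?s = "\<lambda>A k. (- 1) ^ card {j \<in> A. j < k} :: complex"
      have sT: "?s T i * ?s R i = 1"
      proof -
        have "{j \<in> T. j < i} = {j \<in> R. j < i}" using R by auto
        then show ?thesis by (simp flip: power_add mult_2)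
      qed
      have summand: "?s T j * wedge (ext_basis {i}) b (insert j T) =
          - (?s T i * (?s R j * b (insert j R)))"
        if j: "j \<in> {..n} - T" for j
      proof -
        have ji: "j \<noteq> i" "j \<notin> R" using j R by auto
        have "insert j T - {i} = insert j R" using R ji by auto
        then have w: "wedge (ext_basis {i}) b (insert j T) = ?s (insert j T) i * b (insert j R)"
          using R fin by (simp add: wedge_generator)
        have sgn: "?s T j * ?s (insert j T) i = - (?s T i * ?s R j)"
        proof (cases "j < i")
          case True
          have "{k \<in> T. k < j} = {k \<in> R. k < j}" using R True by auto
          moreover have "{k \<in> insert j T. k < i} = insert j {k \<in> T. k < i}" using True by auto
          ultimately show ?thesis using j fin by simp
        next
          case False
          then have "i < j" using ji by simp
          have "{k \<in> T. k < j} = insert i {k \<in> R. k < j}" using R \<open>i < j\<close> by auto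
          moreover have "{k \<in> insert j T. k < i} = {k \<in> T. k < i}" using \<open>i < j\<close> by auto
          ultimately show ?thesis using R by simp
        qed
        show ?thesis
          unfolding w using arg_cong[OF sgn, of "\<lambda>z. z * b (insert j R)"] by (simp add: mult.assoc)
      qed
      have split: "{..n} - R = insert i ({..n} - T)" "i \<notin> {..n} - T" using R assms(1) by auto
      have "wedge (ext_basis {i}) (ext_diff n b) T = ?s T i * ext_diff n b R"
        using True fin by (simp add: wedge_generator R_def)
      also have "ext_diff n b R = ?s R i * b T + (\<Sum>j\<in>{..n} - T. ?s R j * b (insert j R))"
        unfolding ext_diff_def split(1) using split(2) R(1) by simp
      also have "?s T i * \<dots> = b T + (\<Sum>j\<in>{..n} - T. ?s T i * (?s R j * b (insert j R)))"
        using sT by (simp add: distrib_left sum_distrib_left mult.assoc[symmetric])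
      finally have r: "wedge (ext_basis {i}) (ext_diff n b) T = \<dots>" .
      have "ext_diff n (wedge (ext_basis {i}) b) T =
          (\<Sum>j\<in>{..n} - T. - (?s T i * (?s R j * b (insert j R))))"
        unfolding ext_diff_def by (intro sum.cong refl summand)
      then show ?thesis by (simp add: r sum_negf)
    qed
  qed
qed

section \<open>The Orlik--Solomon ideal and the Falk invariant\<close>

definition ext_ideal :: "nat \<Rightarrow> ext set \<Rightarrow> bool" where
  "ext_ideal n J \<longleftrightarrow> J \<subseteq> ext_alg n \<and> cfun.subspace J \<and>
     (\<forall>a\<in>ext_alg n. \<forall>b\<in>J. wedge a b \<in> J \<and> wedge b a \<in> J)"

definition os_ideal :: "nat \<Rightarrow> (nat \<Rightarrow> nat \<Rightarrow> complex) \<Rightarrow> ext set" where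
  "os_ideal n \<alpha> =
     ext_ideal n hull {ext_diff n (ext_basis S) |S. S \<subseteq> {..n} \<and> cfun.dependent (\<alpha> ` S)}"

definition os_ideal_deg :: "nat \<Rightarrow> (nat \<Rightarrow> nat \<Rightarrow> complex) \<Rightarrow> nat \<Rightarrow> ext set" where
  "os_ideal_deg n \<alpha> p = os_ideal n \<alpha> \<inter> ext_deg n p"

text \<open>Over a field, the tensor product of two spaces of functions on \<open>A\<close> and on \<open>B\<close> embeds into
  the functions on \<open>A \<times> B\<close>, and is the span there of the products \<open>v \<otimes> w\<close>.\<close>

definition pure_tensor :: "('a \<Rightarrow> complex) \<Rightarrow> ('b \<Rightarrow> complex) \<Rightarrow> 'a \<times> 'b \<Rightarrow> complex" where
  "pure_tensor v w = (\<lambda>(x, y). v x * w y)"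

definition tensor_product ::
  "('a \<Rightarrow> complex) set \<Rightarrow> ('b \<Rightarrow> complex) set \<Rightarrow> ('a \<times> 'b \<Rightarrow> complex) set" where
  "tensor_product V W = cfun.span {pure_tensor v w |v w. v \<in> V \<and> w \<in> W}"

text \<open>The linear map with \<open>a \<otimes> b \<mapsto> a \<and> b\<close>.\<close>

definition wedge_map :: "(nat set \<times> nat set \<Rightarrow> complex) \<Rightarrow> ext" where
  "wedge_map t = (\<lambda>U. \<Sum>S\<in>Pow U. shuffle_sign S (U - S) * t (S, U - S))"

lemma wedge_map_pure_tensor: "wedge_map (pure_tensor a b) = wedge a b"
  by (simp add: wedge_map_def wedge_def pure_tensor_def mult.assoc)

lemma wedge_map_add: "wedge_map (s + t) = wedge_map s + wedge_map t"
  by (simp add: wedge_map_def fun_eq_iff distrib_left sum.distrib)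

lemma wedge_map_scale: "wedge_map (cscale c t) = cscale c (wedge_map t)"
  by (simp add: wedge_map_def cscale_def sum_distrib_left mult.left_commute)

definition falk_invariant :: "nat \<Rightarrow> (nat \<Rightarrow> nat \<Rightarrow> complex) \<Rightarrow> nat" where
  "falk_invariant n \<alpha> =
     cfun.dim {t \<in> tensor_product (ext_deg n 1) (os_ideal_deg n \<alpha> 2). wedge_map t = 0}"

end

theory Submission
  imports Defs "HOL-Library.Disjoint_Sets"
begin

text \<open>Up to scalars, the forms of the arrangement are \<open>x\<^sub>0\<close> and \<open>f\<^sub>i\<^sub>j = x\<^sub>i - x\<^sub>j - x\<^sub>0\<close> for ordered
  pairs \<open>i \<noteq> j\<close>, and the only dependent sets of at most three of them are the triples
  \<open>{x\<^sub>0, f\<^sub>i\<^sub>j, f\<^sub>j\<^sub>i}\<close>. So \<open>I\<^sup>2\<close> is spanned by the products \<open>g\<^sub>p = \<plusminus>(e\<^sub>a - e\<^sub>z) \<and> (e\<^sub>b - e\<^sub>z)\<close>, where \<open>z\<close> is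
  the index of \<open>x\<^sub>0\<close> and \<open>p = {a, b}\<close> runs through disjoint pairs of indices. Disjointness makes the
  products \<open>e\<^sub>c \<and> g\<^sub>p\<close> with \<open>c \<notin> p \<union> {z}\<close> linearly independent, so the kernel has the basis
  \<open>(e\<^sub>a - e\<^sub>z) \<otimes> g\<^sub>p\<close> with \<open>a \<in> p\<close>, one element for each hyperplane other than \<open>x\<^sub>0 = 0\<close>.\<close>

section \<open>Linear combinations and tensor products of functions\<close>

lemma sum_fun_apply: "sum f A x = (\<Sum>i\<in>A. f i x)" for f :: "'i \<Rightarrow> 'a \<Rightarrow> 'b :: comm_monoid_add"
  by (induction A rule: infinite_finite_induct) auto

lemma sum_cscale_apply: "(\<Sum>i\<in>A. cscale (c i) (f i)) x = (\<Sum>i\<in>A. c i * f i x)"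
  by (simp add: sum_fun_apply cscale_def)

lemma subspace_vanishing_on: "cfun.subspace {f. \<forall>x\<in>X. f x = 0}"
  by (rule cfun.subspaceI) (auto simp: cscale_def)

lemma dependent_image_iff:
  assumes "finite X" and "inj_on h X"
  shows "cfun.dependent (h ` X) \<longleftrightarrow>
    (\<exists>u. (\<exists>x\<in>X. u x \<noteq> 0) \<and> (\<Sum>x\<in>X. cscale (u x) (h x)) = 0)"
proof
  assume "cfun.dependent (h ` X)"
  then obtain u where "\<exists>v\<in>h ` X. u v \<noteq> 0" and "(\<Sum>v\<in>h ` X. cscale (u v) v) = 0"
    using assms(1) by (auto simp: cfun.dependent_finite)
  then show "\<exists>u. (\<exists>x\<in>X. u x \<noteq> 0) \<and> (\<Sum>x\<in>X. cscale (u x) (h x)) = 0"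
    using assms(2) by (intro exI[of _ "u \<circ> h"]) (simp add: sum.reindex)
next
  assume "\<exists>u. (\<exists>x\<in>X. u x \<noteq> 0) \<and> (\<Sum>x\<in>X. cscale (u x) (h x)) = 0"
  then obtain u where "\<exists>x\<in>X. u x \<noteq> 0" and "(\<Sum>x\<in>X. cscale (u x) (h x)) = 0" by blast
  then show "cfun.dependent (h ` X)"
    using assms
    by (auto simp: cfun.dependent_finite sum.reindex intro!: exI[of _ "u \<circ> inv_into X h"])
qed

lemma dependent_image_rescale:
  assumes "finite X" and "inj_on f X" and "inj_on g X"
    and "\<And>x. x \<in> X \<Longrightarrow> c x \<noteq> 0" and "\<And>x. x \<in> X \<Longrightarrow> f x = cscale (c x) (g x)"
  shows "cfun.dependent (f ` X) \<longleftrightarrow> cfun.dependent (g ` X)"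
proof -
  have transfer: "cfun.dependent (g ` X)"
    if f_dep: "cfun.dependent (f ` X)" and inj: "inj_on f X" "inj_on g X"
      and scale: "\<And>x. x \<in> X \<Longrightarrow> c x \<noteq> 0 \<and> f x = cscale (c x) (g x)"
    for f g :: "'a \<Rightarrow> 'b \<Rightarrow> complex" and c
  proof -
    obtain u where nonzero: "\<exists>x\<in>X. u x \<noteq> 0" and zero: "(\<Sum>x\<in>X. cscale (u x) (f x)) = 0"
      using f_dep dependent_image_iff[OF \<open>finite X\<close> inj(1)] by blast
    have "\<exists>x\<in>X. u x * c x \<noteq> 0" using nonzero scale by auto
    moreover have "(\<Sum>x\<in>X. cscale (u x * c x) (g x)) = 0"
      using zero scale by simp
    ultimately show ?thesis
      unfolding dependent_image_iff[OF \<open>finite X\<close> inj(2)]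
      by (intro exI[of _ "\<lambda>x. u x * c x"] conjI)
  qed
  have inverse: "inverse (c x) \<noteq> 0 \<and> g x = cscale (inverse (c x)) (f x)" if "x \<in> X" for x
    using assms(4,5)[OF that] by simp
  show ?thesis
  proof
    show "cfun.dependent (g ` X)" if "cfun.dependent (f ` X)"
      using transfer[OF that assms(2,3)] assms(4,5) by blast
    show "cfun.dependent (f ` X)" if "cfun.dependent (g ` X)"
      using transfer[OF that assms(3,2) inverse] .
  qed
qed

lemma independent_image_if_dual_points:
  assumes "finite X"
    and diagonal: "\<And>x. x \<in> X \<Longrightarrow> h x (y x) \<noteq> 0"
    and off_diagonal: "\<And>x x'. x \<in> X \<Longrightarrow> x' \<in> X \<Longrightarrow> x' \<noteq> x \<Longrightarrow> h x' (y x) = 0"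
  shows "inj_on h X" and "cfun.independent (h ` X)"
proof -
  show inj: "inj_on h X"
    using diagonal off_diagonal by (metis inj_onI)
  have "u x = 0" if zero: "(\<Sum>w\<in>X. cscale (u w) (h w)) = 0" and x: "x \<in> X" for u x
  proof -
    have "0 = (\<Sum>w\<in>X. u w * h w (y x))"
      using fun_cong[OF zero, of "y x"] by (simp add: sum_cscale_apply)
    also have "\<dots> = (\<Sum>w\<in>X. if w = x then u x * h x (y x) else 0)"
      using off_diagonal x by (intro sum.cong) auto
    also have "\<dots> = u x * h x (y x)" using \<open>finite X\<close> x by simp
    finally show ?thesis using diagonal[OF x] by simp
  qed
  then show "cfun.independent (h ` X)"
    using dependent_image_iff[OF \<open>finite X\<close> inj] by blast
qed

global_interpretation pure_tensor_left: Vector_Spaces.linear cscale cscale "\<lambda>v. pure_tensor v w"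
  for w :: "'b \<Rightarrow> complex"
  by unfold_locales (auto simp: pure_tensor_def cscale_def fun_eq_iff algebra_simps)

global_interpretation pure_tensor_right: Vector_Spaces.linear cscale cscale "pure_tensor v"
  for v :: "'a \<Rightarrow> complex"
  by unfold_locales (auto simp: pure_tensor_def cscale_def fun_eq_iff algebra_simps)

lemma tensor_product_span_finite:
  assumes V: "cfun.subspace V" and "finite B"
  shows "tensor_product V (cfun.span B) = {\<Sum>b\<in>B. pure_tensor (a b) b |a. \<forall>b\<in>B. a b \<in> V}"
    (is "_ = ?R")
proof
  have "cfun.subspace ?R"
  proof (rule cfun.subspaceI)
    show "0 \<in> ?R"
      using cfun.subspace_0[OF V] by (auto intro!: exI[of _ "\<lambda>_. 0"])
  next
    fix s t assume "s \<in> ?R" "t \<in> ?R"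
    then obtain a a' where "\<forall>b\<in>B. a b \<in> V" "s = (\<Sum>b\<in>B. pure_tensor (a b) b)"
      and "\<forall>b\<in>B. a' b \<in> V" "t = (\<Sum>b\<in>B. pure_tensor (a' b) b)" by blast
    then show "s + t \<in> ?R"
      using cfun.subspace_add[OF V]
      by (auto intro!: exI[of _ "\<lambda>b. a b + a' b"] simp: pure_tensor_left.add sum.distrib)
  next
    fix k t assume "t \<in> ?R"
    then obtain a where "\<forall>b\<in>B. a b \<in> V" "t = (\<Sum>b\<in>B. pure_tensor (a b) b)" by blast
    then show "cscale k t \<in> ?R"
      using cfun.subspace_scale[OF V]
      by (auto intro!: exI[of _ "\<lambda>b. cscale k (a b)"]
          simp: pure_tensor_left.scale cfun.scale_sum_right)
  qed
  moreover have "pure_tensor v w \<in> ?R" if v: "v \<in> V" and w: "w \<in> cfun.span B" for v w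
  proof -
    obtain u where "w = (\<Sum>b\<in>B. cscale (u b) b)"
      using w cfun.span_finite[OF \<open>finite B\<close>] by auto
    then have "pure_tensor v w = (\<Sum>b\<in>B. pure_tensor (cscale (u b) v) b)"
      by (simp add: pure_tensor_right.sum pure_tensor_right.scale pure_tensor_left.scale)
    then show ?thesis
      using cfun.subspace_scale[OF V v] by (intro CollectI exI[of _ "\<lambda>b. cscale (u b) v"]) simp
  qed
  ultimately show "tensor_product V (cfun.span B) \<subseteq> ?R"
    unfolding tensor_product_def by (intro cfun.span_minimal) auto
  have "pure_tensor v b \<in> tensor_product V (cfun.span B)" if "v \<in> V" and "b \<in> B" for v b
    unfolding tensor_product_def using that cfun.span_base by (intro cfun.span_base) blast
  then show "?R \<subseteq> tensor_product V (cfun.span B)"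
    unfolding tensor_product_def by (auto intro!: cfun.span_sum)
qed

section \<open>The lowest degree of an Orlik--Solomon ideal\<close>

global_interpretation wedge_left: Vector_Spaces.linear cscale cscale "\<lambda>a. wedge a b"
  for b :: ext
  by unfold_locales
    (auto simp: wedge_def cscale_def fun_eq_iff algebra_simps sum.distrib sum_distrib_left)

global_interpretation wedge_map: Vector_Spaces.linear cscale cscale wedge_map
  by unfold_locales (simp_all add: wedge_map_add wedge_map_scale)

lemma subspace_ext_alg: "cfun.subspace (ext_alg n)"
proof -
  have "ext_alg n = {a. \<forall>S\<in>- Pow {..n}. a S = 0}" by (auto simp: ext_alg_def)
  then show ?thesis by (simp only: subspace_vanishing_on)
qed

lemma subspace_ext_deg: "cfun.subspace (ext_deg n p)"
proof -
  have "ext_deg n p = {a. \<forall>S\<in>- {S. S \<subseteq> {..n} \<and> card S = p}. a S = 0}"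
    by (auto simp: ext_deg_def ext_alg_def)
  then show ?thesis by (simp only: subspace_vanishing_on)
qed

lemma ext_basis_in_ext_deg: "S \<subseteq> {..n} \<Longrightarrow> ext_basis S \<in> ext_deg n (card S)"
  by (auto simp: ext_basis_def ext_deg_def ext_alg_def)

lemma wedge_in_ext_alg:
  assumes "a \<in> ext_alg n" and "b \<in> ext_alg n"
  shows "wedge a b \<in> ext_alg n"
proof -
  have "wedge a b U = 0" if U: "\<not> U \<subseteq> {..n}" for U
    unfolding wedge_def
  proof (intro sum.neutral ballI)
    fix S assume "S \<in> Pow U"
    then have "\<not> S \<subseteq> {..n} \<or> \<not> U - S \<subseteq> {..n}" using U by blast
    then show "shuffle_sign S (U - S) * a S * b (U - S) = 0"
      using assms by (auto simp: ext_alg_def)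
  qed
  then show ?thesis by (auto simp: ext_alg_def)
qed

lemma ext_diff_basis_in_ext_deg:
  assumes "S \<subseteq> {..n}" and "card S = Suc p"
  shows "ext_diff n (ext_basis S) \<in> ext_deg n p"
proof -
  have "T \<subseteq> {..n} \<and> card T = p" if nonzero: "ext_diff n (ext_basis S) T \<noteq> 0" for T
  proof -
    obtain i where i: "i \<in> {..n} - T" "ext_basis S (insert i T) \<noteq> 0"
      using sum.not_neutral_contains_not_neutral[OF nonzero[unfolded ext_diff_def]] by auto
    then have "insert i T = S" by (simp add: ext_basis_def split: if_splits)
    moreover have "finite T" using calculation assms(1) finite_subset[of S "{..n}"] by auto
    ultimately show ?thesis using i(1) assms by auto
  qed
  then show ?thesis by (auto simp: ext_deg_def ext_alg_def)
qed

lemma shuffle_sign_empty_right: "shuffle_sign S {} = 1"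
  by (simp add: shuffle_sign_def)

lemma wedge_if_vanishes_on_proper_subsets:
  assumes "finite U" and vanishes: "\<And>T. T \<subset> U \<Longrightarrow> b T = 0"
  shows "wedge a b U = a {} * b U" and "wedge b a U = a {} * b U"
proof -
  have "wedge a b U = (\<Sum>S\<in>Pow U. if S = {} then a {} * b U else 0)"
    unfolding wedge_def
  proof (intro sum.cong refl)
    fix S assume "S \<in> Pow U"
    then show "shuffle_sign S (U - S) * a S * b (U - S) = (if S = {} then a {} * b U else 0)"
      using vanishes[of "U - S"] by (auto simp: shuffle_sign_def)
  qed
  then show "wedge a b U = a {} * b U" using \<open>finite U\<close> by simp
  have "wedge b a U = (\<Sum>S\<in>Pow U. if S = U then a {} * b U else 0)"
    unfolding wedge_def
  proof (intro sum.cong refl)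
    fix S assume "S \<in> Pow U"
    then show "shuffle_sign S (U - S) * b S * a (U - S) = (if S = U then a {} * b U else 0)"
      using vanishes[of S] by (cases "S = U") (auto simp: shuffle_sign_empty_right)
  qed
  then show "wedge b a U = a {} * b U" using \<open>finite U\<close> by simp
qed

definition ext_part :: "nat \<Rightarrow> ext \<Rightarrow> ext" where
  "ext_part p a = (\<lambda>S. if card S = p then a S else 0)"

global_interpretation ext_part: Vector_Spaces.linear cscale cscale "ext_part p"
  by unfold_locales (auto simp: ext_part_def cscale_def)

lemma ext_part_of_deg: "a \<in> ext_deg n q \<Longrightarrow> ext_part p a = (if p = q then a else 0)"
  by (auto simp: ext_part_def ext_deg_def fun_eq_iff)

lemma ext_ideal_lowest_part_in:
  assumes W: "cfun.subspace W"
  shows "ext_ideal n {a \<in> ext_alg n. (\<forall>S. card S < p \<longrightarrow> a S = 0) \<and> ext_part p a \<in> W}"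
    (is "ext_ideal n ?J")
  unfolding ext_ideal_def
proof (intro conjI ballI)
  have "?J = ext_alg n \<inter> {a. \<forall>S\<in>{S. card S < p}. a S = 0} \<inter> ext_part p -` W" by auto
  then show "cfun.subspace ?J"
    by (simp only: cfun.subspace_inter subspace_ext_alg subspace_vanishing_on
        ext_part.subspace_vimage[OF W])
  fix a b assume a: "a \<in> ext_alg n" and b: "b \<in> ?J"
  have wedge_low: "wedge a b U = a {} * b U" "wedge b a U = a {} * b U" if "card U \<le> p" for U
  proof -
    have "wedge a b U = a {} * b U \<and> wedge b a U = a {} * b U"
    proof (cases "finite U")
      case True
      then have "b T = 0" if "T \<subset> U" for T
        using b that psubset_card_mono[OF True that] \<open>card U \<le> p\<close> by auto
      with True show ?thesis by (simp add: wedge_if_vanishes_on_proper_subsets)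
    next
      case False
      then have "b U = 0" using b finite_subset[of U "{..n}"] by (auto simp: ext_alg_def)
      with False show ?thesis by (simp add: wedge_infinite)
    qed
    then show "wedge a b U = a {} * b U" "wedge b a U = a {} * b U" by auto
  qed
  have "ext_part p (wedge a b) = cscale (a {}) (ext_part p b)"
    and "ext_part p (wedge b a) = cscale (a {}) (ext_part p b)"
    by (auto simp: ext_part_def cscale_def wedge_low)
  then show "wedge a b \<in> ?J" and "wedge b a \<in> ?J"
    using a b cfun.subspace_scale[OF W] by (auto simp: wedge_in_ext_alg wedge_low)
qed auto

theorem os_ideal_deg_lowest:
  assumes low: "\<And>S. S \<subseteq> {..n} \<Longrightarrow> cfun.dependent (\<alpha> ` S) \<Longrightarrow> p < card S"
  shows "os_ideal_deg n \<alpha> p = cfun.span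
    ((\<lambda>S. ext_diff n (ext_basis S)) ` {S. S \<subseteq> {..n} \<and> card S = Suc p \<and> cfun.dependent (\<alpha> ` S)})"
    (is "_ = cfun.span ?G")
proof
  define J where
    "J = {a \<in> ext_alg n. (\<forall>S. card S < p \<longrightarrow> a S = 0) \<and> ext_part p a \<in> cfun.span ?G}"
  have ideal: "ext_ideal n J"
    unfolding J_def by (intro ext_ideal_lowest_part_in cfun.subspace_span)
  have "ext_diff n (ext_basis S) \<in> J" if S: "S \<subseteq> {..n}" "cfun.dependent (\<alpha> ` S)" for S
  proof -
    obtain q where q: "card S = Suc q" "p \<le> q"
      using low[OF S] by (cases "card S") auto
    have deg: "ext_diff n (ext_basis S) \<in> ext_deg n q"
      using S q ext_diff_basis_in_ext_deg by blast
    have "ext_part p (ext_diff n (ext_basis S)) \<in> cfun.span ?G"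
      using S q by (auto simp: ext_part_of_deg[OF deg] cfun.span_zero intro!: cfun.span_base)
    then show ?thesis
      using deg q by (force simp: J_def ext_deg_def)
  qed
  with ideal have "os_ideal n \<alpha> \<subseteq> J"
    unfolding os_ideal_def by (intro hull_minimal) auto
  then show "os_ideal_deg n \<alpha> p \<subseteq> cfun.span ?G"
    by (auto simp: os_ideal_deg_def J_def ext_part_of_deg)
  have "cfun.subspace (os_ideal n \<alpha>)"
    unfolding os_ideal_def hull_def by (auto simp: ext_ideal_def intro!: cfun.subspace_Inter)
  then have "cfun.subspace (os_ideal_deg n \<alpha> p)"
    unfolding os_ideal_deg_def by (intro cfun.subspace_inter subspace_ext_deg)
  moreover have "?G \<subseteq> os_ideal_deg n \<alpha> p"
    unfolding os_ideal_deg_def os_ideal_def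
    by (auto intro!: hull_inc ext_diff_basis_in_ext_deg)
  ultimately show "cfun.span ?G \<subseteq> os_ideal_deg n \<alpha> p"
    by (intro cfun.span_minimal)
qed

section \<open>Circuits that share a single point\<close>

definition wedge_kernel :: "nat \<Rightarrow> ext set \<Rightarrow> (nat set \<times> nat set \<Rightarrow> complex) set" where
  "wedge_kernel n W = {t \<in> tensor_product (ext_deg n 1) W. wedge_map t = 0}"

lemma subspace_wedge_kernel: "cfun.subspace (wedge_kernel n W)"
proof -
  have "wedge_kernel n W = tensor_product (ext_deg n 1) W \<inter> {t. wedge_map t = 0}"
    by (auto simp: wedge_kernel_def)
  then show ?thesis
    by (simp only: tensor_product_def cfun.subspace_inter cfun.subspace_span
        wedge_map.subspace_kernel)
qed

lemma ext_deg_one_eq_sum: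
  assumes a: "a \<in> ext_deg n 1" and "A \<subseteq> {..n}" and off: "\<And>i. i \<in> {..n} - A \<Longrightarrow> a {i} = 0"
  shows "a = (\<Sum>i\<in>A. cscale (a {i}) (ext_basis {i}))"
proof
  fix S
  have sum_eq: "(\<Sum>i\<in>A. cscale (a {i}) (ext_basis {i})) S = (\<Sum>i\<in>A. if S = {i} then a S else 0)"
    unfolding sum_cscale_apply by (rule sum.cong) (auto simp: ext_basis_def)
  show "a S = (\<Sum>i\<in>A. cscale (a {i}) (ext_basis {i})) S"
  proof (cases "\<exists>i\<in>A. S = {i}")
    case True
    moreover have "finite A" using \<open>A \<subseteq> {..n}\<close> by (rule finite_subset) simp
    ultimately show ?thesis unfolding sum_eq by auto
  next
    case False
    then have "a S = 0"
      using a off by (force simp: ext_deg_def ext_alg_def card_1_singleton_iff)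
    with False show ?thesis unfolding sum_eq by auto
  qed
qed

lemma wedge_deg_one_eq_sum:
  assumes "a \<in> ext_deg n 1" and "A \<subseteq> {..n}" and "\<And>i. i \<in> {..n} - A \<Longrightarrow> a {i} = 0"
  shows "wedge a b = (\<Sum>i\<in>A. cscale (a {i}) (wedge (ext_basis {i}) b))"
  using arg_cong[OF ext_deg_one_eq_sum[OF assms], of "\<lambda>a. wedge a b"]
  by (simp only: wedge_left.sum wedge_left.scale)

lemma wedge_generator_ext_diff_basis:
  assumes "S \<subseteq> {..n}" and "i \<in> S"
  shows "wedge (ext_basis {i}) (ext_diff n (ext_basis S)) = ext_basis S"
proof -
  have "wedge (ext_basis {i}) (ext_basis S) U = 0" for U
    using \<open>i \<in> S\<close>
    by (cases "finite U") (auto simp: wedge_generator wedge_infinite ext_basis_def[of S])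
  then have "ext_diff n (wedge (ext_basis {i}) (ext_basis S)) = 0"
    by (auto simp: ext_diff_def)
  moreover have "ext_basis S \<in> ext_alg n"
    using ext_basis_in_ext_deg[OF \<open>S \<subseteq> {..n}\<close>] by (simp add: ext_deg_def)
  ultimately show ?thesis
    using ext_diff_wedge_generator[of i n "ext_basis S"] assms by auto
qed

lemma ext_diff_basis_insert_apply:
  assumes "z \<le> n" and "z \<notin> p" and "z \<notin> T"
  shows "ext_diff n (ext_basis (insert z p)) T = (if T = p then (- 1) ^ card {j \<in> p. j < z} else 0)"
proof -
  have insert_eq: "insert i T = insert z p \<longleftrightarrow> i = z \<and> T = p" if "i \<notin> T" for i
    using assms that by (metis insertE insertI1 insert_ident)
  have "ext_diff n (ext_basis (insert z p)) T =
      (\<Sum>i\<in>{..n} - T. if i = z then (if T = p then (- 1) ^ card {j \<in> p. j < z} else 0) else 0)"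
    unfolding ext_diff_def by (rule sum.cong) (auto simp: insert_eq ext_basis_def)
  then show ?thesis using assms by simp
qed

locale circuit_bouquet =
  fixes n z :: nat and P :: "nat set set"
  assumes center_le: "z \<le> n"
    and petals_subset: "\<Union>P \<subseteq> {..n} - {z}"
    and petals_disjoint: "disjoint P"
    and card_petal: "p \<in> P \<Longrightarrow> 2 \<le> card p"
begin

definition boundary :: "nat set \<Rightarrow> ext" where
  "boundary p = ext_diff n (ext_basis (insert z p))"

definition spoke :: "nat \<Rightarrow> ext" where
  "spoke i = ext_basis {i} - ext_basis {z}"

definition syzygy :: "nat set \<times> nat \<Rightarrow> nat set \<times> nat set \<Rightarrow> complex" where
  "syzygy = (\<lambda>(p, i). pure_tensor (spoke i) (boundary p))"

lemma circuit_subset: "p \<in> P \<Longrightarrow> insert z p \<subseteq> {..n}"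
  using petals_subset center_le by blast

lemma center_notin_petal: "p \<in> P \<Longrightarrow> z \<notin> p"
  using petals_subset by blast

lemma finite_petal: "p \<in> P \<Longrightarrow> finite p"
  by (rule finite_subset[of _ "{..n}"]) (use petals_subset in auto)

lemma finite_petals: "finite P"
  using petals_subset by (intro finite_UnionD) (rule finite_subset, auto)

lemma boundary_apply:
  "p \<in> P \<Longrightarrow> z \<notin> T \<Longrightarrow> boundary p T = (if T = p then (- 1) ^ card {j \<in> p. j < z} else 0)"
  unfolding boundary_def
  by (rule ext_diff_basis_insert_apply[OF center_le center_notin_petal])

lemma inj_on_boundary: "inj_on boundary P"
proof (rule inj_onI)
  fix p q assume p: "p \<in> P" and q: "q \<in> P" and eq: "boundary p = boundary q"
  have "boundary q p \<noteq> 0"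
    using p center_notin_petal[OF p] by (simp add: boundary_apply flip: eq)
  then show "p = q"
    using boundary_apply[OF q center_notin_petal[OF p]] by (simp split: if_splits)
qed

lemma wedge_generator_boundary:
  "p \<in> P \<Longrightarrow> i \<in> insert z p \<Longrightarrow> wedge (ext_basis {i}) (boundary p) = ext_basis (insert z p)"
  unfolding boundary_def by (intro wedge_generator_ext_diff_basis circuit_subset)

text \<open>A petal contained in \<open>insert i p\<close> meets \<open>p\<close>, because it has at least two elements, hence is
  equal to \<open>p\<close>.\<close>

lemma wedge_generator_boundary_off_circuit:
  assumes p: "p \<in> P" and q: "q \<in> P" and i: "i \<notin> insert z p"
  shows "wedge (ext_basis {j}) (boundary q) (insert i p) \<noteq> 0 \<longleftrightarrow> j = i \<and> q = p"
proof -
  let ?U = "insert i p"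
  have "finite ?U" and center: "z \<notin> ?U - {j}"
    using finite_petal[OF p] center_notin_petal[OF p] i by auto
  then have "wedge (ext_basis {j}) (boundary q) ?U \<noteq> 0 \<longleftrightarrow> j \<in> ?U \<and> boundary q (?U - {j}) \<noteq> 0"
    by (simp add: wedge_generator)
  also have "\<dots> \<longleftrightarrow> j \<in> ?U \<and> q = ?U - {j}"
    using boundary_apply[OF q center] by auto
  also have "\<dots> \<longleftrightarrow> j = i \<and> q = p"
  proof
    assume q_eq: "j \<in> ?U \<and> q = ?U - {j}"
    have "\<not> p \<subseteq> {j}"
      using card_petal[OF p] card_mono[of "{j}" p] by auto
    then have "\<not> disjnt p q" using q_eq by (auto simp: disjnt_def)
    then have "q = p" using petals_disjoint p q by (metis pairwiseD)
    then show "j = i \<and> q = p" using q_eq i by auto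
  qed (use i in auto)
  finally show ?thesis .
qed

lemma wedge_boundary:
  assumes p: "p \<in> P" and a: "a \<in> ext_deg n 1"
    and off: "\<And>i. i \<in> {..n} - insert z p \<Longrightarrow> a {i} = 0"
  shows "wedge a (boundary p) = cscale (\<Sum>i\<in>insert z p. a {i}) (ext_basis (insert z p))"
proof -
  have "wedge a (boundary p) =
      (\<Sum>i\<in>insert z p. cscale (a {i}) (wedge (ext_basis {i}) (boundary p)))"
    by (rule wedge_deg_one_eq_sum[OF a circuit_subset[OF p] off])
  also have "\<dots> = (\<Sum>i\<in>insert z p. cscale (a {i}) (ext_basis (insert z p)))"
    using wedge_generator_boundary[OF p] by (intro sum.cong) auto
  finally show ?thesis by (simp only: cfun.scale_sum_left)
qed

context
  fixes a :: "nat set \<Rightarrow> ext"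
  assumes deg_one: "\<And>p. p \<in> P \<Longrightarrow> a p \<in> ext_deg n 1"
    and sum_wedge_zero: "(\<Sum>p\<in>P. wedge (a p) (boundary p)) = 0"
begin

lemma coefficient_off_circuit_eq_zero:
  assumes p: "p \<in> P" and i: "i \<in> {..n} - insert z p"
  shows "a p {i} = 0"
proof -
  let ?U = "insert i p"
  let ?c = "\<lambda>q j. a q {j} * wedge (ext_basis {j}) (boundary q) ?U"
  have "0 = (\<Sum>q\<in>P. wedge (a q) (boundary q)) ?U"
    by (simp add: sum_wedge_zero)
  also have "\<dots> = (\<Sum>q\<in>P. \<Sum>j\<le>n. ?c q j)"
  proof (unfold sum_fun_apply, rule sum.cong[OF refl])
    fix q assume q: "q \<in> P"
    have "wedge (a q) (boundary q) =
        (\<Sum>j\<le>n. cscale (a q {j}) (wedge (ext_basis {j}) (boundary q)))"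
      by (rule wedge_deg_one_eq_sum[OF deg_one[OF q]]) auto
    then show "wedge (a q) (boundary q) ?U = (\<Sum>j\<le>n. ?c q j)"
      by (simp add: sum_cscale_apply)
  qed
  also have "\<dots> = (\<Sum>q\<in>P. \<Sum>j\<le>n. if j = i then if q = p then ?c p i else 0 else 0)"
    using wedge_generator_boundary_off_circuit[OF p] i by (intro sum.cong refl) auto
  also have "\<dots> = ?c p i"
    using finite_petals p i by simp
  finally show ?thesis
    using wedge_generator_boundary_off_circuit[OF p p, of i i] i by simp
qed

lemma sum_coefficients_on_circuit_eq_zero:
  assumes p: "p \<in> P"
  shows "(\<Sum>i\<in>insert z p. a p {i}) = 0"
proof -
  have circuit_eq: "insert z p = insert z q \<longleftrightarrow> q = p" if "q \<in> P" for q
    using center_notin_petal p that by (metis insert_ident)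
  have "0 = (\<Sum>q\<in>P. wedge (a q) (boundary q)) (insert z p)"
    by (simp add: sum_wedge_zero)
  also have "\<dots> = (\<Sum>q\<in>P. if q = p then \<Sum>i\<in>insert z p. a p {i} else 0)"
  proof (unfold sum_fun_apply, rule sum.cong[OF refl])
    fix q assume q: "q \<in> P"
    have "wedge (a q) (boundary q) =
        cscale (\<Sum>i\<in>insert z q. a q {i}) (ext_basis (insert z q))"
      using coefficient_off_circuit_eq_zero[OF q] by (rule wedge_boundary[OF q deg_one[OF q]])
    then show "wedge (a q) (boundary q) (insert z p) =
        (if q = p then \<Sum>i\<in>insert z p. a p {i} else 0)"
      by (simp add: circuit_eq[OF q] cscale_def ext_basis_def)
  qed
  also have "\<dots> = (\<Sum>i\<in>insert z p. a p {i})"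
    using finite_petals p by simp
  finally show ?thesis by simp
qed

lemma eq_sum_spokes:
  assumes p: "p \<in> P"
  shows "a p = (\<Sum>i\<in>p. cscale (a p {i}) (spoke i))"
proof -
  have center: "a p {z} = - (\<Sum>i\<in>p. a p {i})"
    using sum_coefficients_on_circuit_eq_zero[OF p] center_notin_petal[OF p] finite_petal[OF p]
    by (simp add: add_eq_0_iff2)
  have "a p = (\<Sum>i\<in>insert z p. cscale (a p {i}) (ext_basis {i}))"
    using ext_deg_one_eq_sum[OF deg_one[OF p] circuit_subset[OF p]]
      coefficient_off_circuit_eq_zero[OF p] by blast
  also have "\<dots> = cscale (a p {z}) (ext_basis {z}) + (\<Sum>i\<in>p. cscale (a p {i}) (ext_basis {i}))"
    using center_notin_petal[OF p] finite_petal[OF p] by simp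
  also have "\<dots> = (\<Sum>i\<in>p. cscale (a p {i}) (spoke i))"
    by (simp add: center spoke_def cfun.scale_sum_left cfun.scale_right_diff_distrib sum_subtractf)
  finally show ?thesis .
qed

end

lemma syzygy_in_wedge_kernel:
  assumes p: "p \<in> P" and i: "i \<in> p"
  shows "syzygy (p, i) \<in> wedge_kernel n (cfun.span (boundary ` P))"
proof -
  have "{i} \<subseteq> {..n}" and "{z} \<subseteq> {..n}"
    using circuit_subset[OF p] i by auto
  then have "spoke i \<in> ext_deg n 1"
    unfolding spoke_def using ext_basis_in_ext_deg[of "{_}" n]
    by (intro cfun.subspace_diff subspace_ext_deg) auto
  then have "syzygy (p, i) \<in> tensor_product (ext_deg n 1) (cfun.span (boundary ` P))"
    unfolding syzygy_def tensor_product_def using p by (auto intro!: cfun.span_base)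
  moreover have "wedge_map (syzygy (p, i)) =
      wedge (ext_basis {i}) (boundary p) - wedge (ext_basis {z}) (boundary p)"
    by (simp add: syzygy_def spoke_def wedge_map_pure_tensor wedge_left.diff)
  ultimately show ?thesis
    using p i by (simp add: wedge_kernel_def wedge_generator_boundary)
qed

lemma wedge_kernel_eq_span_syzygies:
  "wedge_kernel n (cfun.span (boundary ` P)) = cfun.span (syzygy ` (SIGMA p:P. p))"
    (is "?K = cfun.span ?S")
proof
  show "cfun.span ?S \<subseteq> ?K"
    using syzygy_in_wedge_kernel by (intro cfun.span_minimal subspace_wedge_kernel) auto
  show "?K \<subseteq> cfun.span ?S"
  proof
    fix t assume t: "t \<in> ?K"
    then obtain a where "\<forall>b\<in>boundary ` P. a b \<in> ext_deg n 1"
      and "t = (\<Sum>b\<in>boundary ` P. pure_tensor (a b) b)"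
      unfolding wedge_kernel_def
        tensor_product_span_finite[OF subspace_ext_deg finite_imageI[OF finite_petals]]
      by blast
    then have deg: "\<And>p. p \<in> P \<Longrightarrow> a (boundary p) \<in> ext_deg n 1"
      and t_eq: "t = (\<Sum>p\<in>P. pure_tensor (a (boundary p)) (boundary p))"
      by (auto simp: sum.reindex[OF inj_on_boundary])
    have "wedge_map t = (\<Sum>p\<in>P. wedge (a (boundary p)) (boundary p))"
      by (simp add: t_eq wedge_map.sum wedge_map_pure_tensor)
    then have "(\<Sum>p\<in>P. wedge (a (boundary p)) (boundary p)) = 0"
      using t by (simp add: wedge_kernel_def)
    then have "a (boundary p) = (\<Sum>i\<in>p. cscale (a (boundary p) {i}) (spoke i))" if "p \<in> P" for p
      using eq_sum_spokes[of "a \<circ> boundary"] deg that by simp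
    then have "t = (\<Sum>p\<in>P. pure_tensor (\<Sum>i\<in>p. cscale (a (boundary p) {i}) (spoke i)) (boundary p))"
      using t_eq by simp
    also have "\<dots> = (\<Sum>p\<in>P. \<Sum>i\<in>p. cscale (a (boundary p) {i}) (syzygy (p, i)))"
      by (simp add: syzygy_def pure_tensor_left.sum pure_tensor_left.scale)
    also have "\<dots> \<in> cfun.span ?S"
      by (intro cfun.span_sum cfun.span_scale cfun.span_base) auto
    finally show "t \<in> cfun.span ?S" .
  qed
qed

theorem dim_wedge_kernel: "cfun.dim (wedge_kernel n (cfun.span (boundary ` P))) = card (\<Union>P)"
proof -
  let ?X = "SIGMA p:P. p"
  have syzygy_at: "syzygy (q, j) ({i}, p) \<noteq> 0 \<longleftrightarrow> (q, j) = (p, i)"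
    if "(p, i) \<in> ?X" "(q, j) \<in> ?X" for p i q j
    using that center_notin_petal
    by (auto simp: syzygy_def pure_tensor_def spoke_def ext_basis_def boundary_apply)
  have "finite ?X" using finite_petals finite_petal by auto
  then have inj: "inj_on syzygy ?X" and "cfun.independent (syzygy ` ?X)"
    using independent_image_if_dual_points[of ?X syzygy "\<lambda>(p, i). ({i}, p)"] syzygy_at by auto
  then have "cfun.dim (cfun.span (syzygy ` ?X)) = card ?X"
    using card_image[OF inj] by (simp add: cfun.dim_eq_card_independent)
  also have "card ?X = (\<Sum>p\<in>P. card p)"
    using finite_petals finite_petal by simp
  also have "\<dots> = card (\<Union>P)"
    using petals_disjoint finite_petal by (simp add: card_Union_disjoint)
  finally show ?thesis by (simp add: wedge_kernel_eq_span_syzygies)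
qed

end

theorem falk_invariant_disjoint_pairs:
  assumes "z \<le> n" and P: "\<Union>P \<subseteq> {..n} - {z}" "disjoint P" "\<And>p. p \<in> P \<Longrightarrow> card p = 2"
    and dep: "\<And>S. S \<subseteq> {..n} \<Longrightarrow> card S \<le> 3 \<Longrightarrow> cfun.dependent (\<alpha> ` S) \<longleftrightarrow> S \<in> insert z ` P"
  shows "falk_invariant n \<alpha> = card (\<Union>P)"
proof -
  interpret circuit_bouquet n z P
    using assms by unfold_locales auto
  have card_circuit: "card (insert z p) = 3" if "p \<in> P" for p
    using P(3)[OF that] finite_petal[OF that] center_notin_petal[OF that] by simp
  have "2 < card S" if "S \<subseteq> {..n}" "cfun.dependent (\<alpha> ` S)" for S
    using dep[OF that(1)] that(2) card_circuit by (cases "card S \<le> 3") auto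
  moreover have "{S. S \<subseteq> {..n} \<and> card S = Suc 2 \<and> cfun.dependent (\<alpha> ` S)} = insert z ` P"
  proof (intro equalityI subsetI)
    fix S assume "S \<in> insert z ` P"
    then have "S \<subseteq> {..n}" and "card S = 3" and "cfun.dependent (\<alpha> ` S)"
      using circuit_subset card_circuit dep[of S] by auto
    then show "S \<in> {S. S \<subseteq> {..n} \<and> card S = Suc 2 \<and> cfun.dependent (\<alpha> ` S)}" by simp
  qed (use dep in auto)
  ultimately have "os_ideal_deg n \<alpha> 2 = cfun.span (boundary ` P)"
    using os_ideal_deg_lowest[of n \<alpha> 2] by (simp add: boundary_def image_image)
  then show ?thesis
    using dim_wedge_kernel by (simp add: falk_invariant_def wedge_kernel_def)
qed

section \<open>Change of defining forms\<close>

lemma hyperplane_eq_imp_proportional: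
  assumes a: "a \<in> coord_space d" "a \<noteq> 0" and b: "b \<in> coord_space d" "b \<noteq> 0"
    and eq: "hyperplane d a = hyperplane d b"
  shows "\<exists>c. c \<noteq> 0 \<and> a = cscale c b"
proof -
  obtain m where m: "b m \<noteq> 0" using b(2) by (auto simp: fun_eq_iff)
  then have m_less: "m < d" using b(1) by (force simp: coord_space_def not_le[symmetric])
  have cross: "b m * a k = b k * a m" if k: "k < d" "k \<noteq> m" for k
  proof -
    define x where "x = (\<lambda>i. if i = k then b m else if i = m then - b k else 0)"
    have dot: "(\<Sum>i<d. w i * x i) = w k * b m - w m * b k" for w
    proof -
      have "(\<Sum>i<d. w i * x i) = (\<Sum>i\<in>{k, m}. w i * x i)"
        using k m_less by (intro sum.mono_neutral_right) (auto simp: x_def)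
      then show ?thesis using k by (simp add: x_def)
    qed
    have "x \<in> coord_space d" using k m_less by (auto simp: coord_space_def x_def)
    then have "x \<in> hyperplane d b" by (simp add: hyperplane_def dot)
    then have "x \<in> hyperplane d a" by (simp add: eq)
    then show ?thesis by (simp add: hyperplane_def dot algebra_simps)
  qed
  have "a k = (a m / b m) * b k" for k
  proof (cases "k < d \<and> k \<noteq> m")
    case True
    then show ?thesis using cross[of k] m by (simp add: field_simps)
  next
    case False
    then show ?thesis using m a(1) b(1) by (auto simp: coord_space_def)
  qed
  then have "a = cscale (a m / b m) b" unfolding cscale_def by (rule ext)
  moreover from this have "a m / b m \<noteq> 0" using a(2) by auto
  ultimately show ?thesis by blast
qed

lemma defining_forms_eq_scaled_relabelling:
  assumes \<alpha>: "defining_forms d n \<alpha> \<A>"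
    and \<beta>: "\<And>x. x \<in> L \<Longrightarrow> \<beta> x \<in> coord_space d \<and> \<beta> x \<noteq> 0"
    and \<beta>_bij: "bij_betw (\<lambda>x. hyperplane d (\<beta> x)) L \<A>"
  obtains \<tau> c where "bij_betw \<tau> L {..n}"
    and "\<And>x. x \<in> L \<Longrightarrow> c x \<noteq> 0" and "\<And>x. x \<in> L \<Longrightarrow> \<alpha> (\<tau> x) = cscale (c x) (\<beta> x)"
proof -
  have \<alpha>_bij: "bij_betw (\<lambda>i. hyperplane d (\<alpha> i)) {..n} \<A>"
    and \<alpha>_form: "\<And>i. i \<le> n \<Longrightarrow> \<alpha> i \<in> coord_space d \<and> \<alpha> i \<noteq> 0"
    using \<alpha> by (auto simp: defining_forms_def)
  define \<tau> where "\<tau> = inv_into {..n} (\<lambda>i. hyperplane d (\<alpha> i)) \<circ> (\<lambda>x. hyperplane d (\<beta> x))"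
  have \<tau>_bij: "bij_betw \<tau> L {..n}"
    unfolding \<tau>_def using \<beta>_bij bij_betw_inv_into[OF \<alpha>_bij] by (rule bij_betw_trans)
  have "hyperplane d (\<alpha> (\<tau> x)) = hyperplane d (\<beta> x)" if "x \<in> L" for x
  proof -
    have "hyperplane d (\<beta> x) \<in> (\<lambda>i. hyperplane d (\<alpha> i)) ` {..n}"
      using that bij_betwE[OF \<beta>_bij] bij_betw_imp_surj_on[OF \<alpha>_bij] by simp
    from f_inv_into_f[OF this] show ?thesis by (simp add: \<tau>_def)
  qed
  then have "\<exists>c. c \<noteq> 0 \<and> \<alpha> (\<tau> x) = cscale c (\<beta> x)" if "x \<in> L" for x
    using that \<beta>[OF that] \<alpha>_form bij_betwE[OF \<tau>_bij] hyperplane_eq_imp_proportional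
    by (metis atMost_iff)
  then obtain c where "\<And>x. x \<in> L \<Longrightarrow> c x \<noteq> 0 \<and> \<alpha> (\<tau> x) = cscale (c x) (\<beta> x)" by metis
  with \<tau>_bij show thesis by (intro that[of \<tau> c]) auto
qed

lemma defining_forms_same_dependencies:
  assumes \<alpha>: "defining_forms d n \<alpha> \<A>"
    and \<beta>: "\<And>x. x \<in> L \<Longrightarrow> \<beta> x \<in> coord_space d \<and> \<beta> x \<noteq> 0"
    and \<beta>_bij: "bij_betw (\<lambda>x. hyperplane d (\<beta> x)) L \<A>"
  obtains \<tau> where "bij_betw \<tau> L {..n}"
    and "\<And>T. T \<subseteq> L \<Longrightarrow> cfun.dependent (\<alpha> ` \<tau> ` T) \<longleftrightarrow> cfun.dependent (\<beta> ` T)"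
proof -
  obtain \<tau> c where \<tau>: "bij_betw \<tau> L {..n}" and c: "\<And>x. x \<in> L \<Longrightarrow> c x \<noteq> 0"
    and \<alpha>_\<tau>: "\<And>x. x \<in> L \<Longrightarrow> \<alpha> (\<tau> x) = cscale (c x) (\<beta> x)"
    using defining_forms_eq_scaled_relabelling[OF assms] by blast
  have "inj_on \<alpha> {..n}" and inj_\<beta>: "inj_on \<beta> L"
    using \<alpha> \<beta>_bij by (auto simp: defining_forms_def bij_betw_def inj_on_def)
  then have inj_\<alpha>_\<tau>: "inj_on (\<lambda>x. \<alpha> (\<tau> x)) L"
    using \<tau> comp_inj_on[of \<tau> L \<alpha>] by (simp add: bij_betw_def comp_def)
  have "cfun.dependent ((\<lambda>x. \<alpha> (\<tau> x)) ` T) \<longleftrightarrow> cfun.dependent (\<beta> ` T)" if "T \<subseteq> L" for T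
  proof (rule dependent_image_rescale[where c = c])
    show "finite T" using that bij_betw_finite[OF \<tau>] finite_subset by auto
    show "inj_on (\<lambda>x. \<alpha> (\<tau> x)) T" and "inj_on \<beta> T"
      using inj_\<alpha>_\<tau> inj_\<beta> that by (auto intro: inj_on_subset)
  qed (use that c \<alpha>_\<tau> in auto)
  with \<tau> show thesis by (intro that[of \<tau>]) (auto simp: image_image)
qed

lemma image_mem_insert_image_iff:
  assumes inj: "inj_on \<tau> L" and "T \<subseteq> L" and "z \<in> L" and "\<Union>Q \<subseteq> L"
  shows "\<tau> ` T \<in> insert (\<tau> z) ` (`) \<tau> ` Q \<longleftrightarrow> T \<in> insert z ` Q"
proof -
  have "\<tau> ` T \<in> (`) \<tau> ` insert z ` Q \<longleftrightarrow> T \<in> insert z ` Q"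
    using assms(2-) by (intro inj_on_image_mem_iff[OF inj_on_image_Pow[OF inj]]) auto
  then show ?thesis by (simp add: image_image)
qed

theorem falk_invariant_labelled_disjoint_pairs:
  assumes \<alpha>: "defining_forms d n \<alpha> \<A>"
    and \<beta>: "\<And>x. x \<in> L \<Longrightarrow> \<beta> x \<in> coord_space d \<and> \<beta> x \<noteq> 0"
    and \<beta>_bij: "bij_betw (\<lambda>x. hyperplane d (\<beta> x)) L \<A>"
    and "z \<in> L" and Q: "\<Union>Q \<subseteq> L - {z}" "disjoint Q" "\<And>q. q \<in> Q \<Longrightarrow> card q = 2"
    and dep: "\<And>T. T \<subseteq> L \<Longrightarrow> card T \<le> 3 \<Longrightarrow> cfun.dependent (\<beta> ` T) \<longleftrightarrow> T \<in> insert z ` Q"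
  shows "falk_invariant n \<alpha> = card (\<Union>Q)"
proof -
  obtain \<tau> where \<tau>: "bij_betw \<tau> L {..n}"
    and same_dep: "\<And>T. T \<subseteq> L \<Longrightarrow> cfun.dependent (\<alpha> ` \<tau> ` T) \<longleftrightarrow> cfun.dependent (\<beta> ` T)"
    using defining_forms_same_dependencies[OF \<alpha> \<beta> \<beta>_bij] by blast
  have inj_\<tau>: "inj_on \<tau> L" and range_\<tau>: "\<tau> ` L = {..n}"
    using \<tau> by (auto simp: bij_betw_def)
  have inj_sub: "inj_on \<tau> X" if "X \<subseteq> L" for X
    using inj_\<tau> that by (rule inj_on_subset)
  have Union_Q: "\<Union>Q \<subseteq> L" using Q(1) by blast
  have Union_image: "\<Union>((`) \<tau> ` Q) = \<tau> ` \<Union>Q" by blast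
  have "falk_invariant n \<alpha> = card (\<Union>((`) \<tau> ` Q))"
  proof (rule falk_invariant_disjoint_pairs)
    show "\<tau> z \<le> n" using \<open>z \<in> L\<close> range_\<tau> by blast
    show "\<Union>((`) \<tau> ` Q) \<subseteq> {..n} - {\<tau> z}"
      using image_mono[OF Q(1), of \<tau>] inj_on_image_set_diff[OF inj_\<tau>, of L "{z}"] \<open>z \<in> L\<close>
      by (simp add: Union_image range_\<tau>)
    show "disjoint ((`) \<tau> ` Q)"
      using inj_sub Q by (intro disjoint_image) auto
    show "card p = 2" if p: "p \<in> (`) \<tau> ` Q" for p
    proof -
      obtain q where q: "q \<in> Q" "p = \<tau> ` q" using p by blast
      then have "q \<subseteq> L" using Union_Q by blast
      then show ?thesis using q by (simp add: card_image inj_sub Q(3))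
    qed
  next
    fix S assume S: "S \<subseteq> {..n}" "card S \<le> 3"
    then obtain T where T: "T \<subseteq> L" "S = \<tau> ` T"
      unfolding range_\<tau>[symmetric] by (meson subset_image_iff)
    have "cfun.dependent (\<alpha> ` S) \<longleftrightarrow> cfun.dependent (\<beta> ` T)"
      using same_dep T by simp
    also have "\<dots> \<longleftrightarrow> T \<in> insert z ` Q"
      using dep T S(2) by (simp add: card_image inj_sub)
    also have "\<dots> \<longleftrightarrow> S \<in> insert (\<tau> z) ` (`) \<tau> ` Q"
      unfolding T(2)
      by (rule image_mem_insert_image_iff[OF inj_\<tau> T(1) \<open>z \<in> L\<close> Union_Q, symmetric])
    finally show "cfun.dependent (\<alpha> ` S) \<longleftrightarrow> S \<in> insert (\<tau> z) ` (`) \<tau> ` Q" .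
  qed
  also have "\<dots> = card (\<Union>Q)"
    unfolding Union_image by (rule card_image[OF inj_sub[OF Union_Q]])
  finally show ?thesis .
qed

section \<open>The cone of the semiorder arrangement\<close>

text \<open>The label \<open>(i, j)\<close> stands for the form \<open>x\<^sub>i - x\<^sub>j - x\<^sub>0\<close>. The hyperplane \<open>x\<^sub>i - x\<^sub>j + x\<^sub>0 = 0\<close>
  then has the label \<open>(j, i)\<close>, and the hyperplane \<open>x\<^sub>0 = 0\<close> has the label \<open>(0, 0)\<close>.\<close>

definition semiorder_form :: "nat \<times> nat \<Rightarrow> nat \<Rightarrow> complex" where
  "semiorder_form = (\<lambda>(i, j) k. of_bool (k = i) - of_bool (k = j) - of_bool (k = 0))"

definition semiorder_edges :: "nat \<Rightarrow> (nat \<times> nat) set" where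
  "semiorder_edges l = (SIGMA i:{1..l}. {1..l} - {i})"

definition semiorder_labels :: "nat \<Rightarrow> (nat \<times> nat) set" where
  "semiorder_labels l = insert (0, 0) (semiorder_edges l)"

definition opposite_pairs :: "nat \<Rightarrow> (nat \<times> nat) set set" where
  "opposite_pairs l = (\<lambda>e. {e, prod.swap e}) ` semiorder_edges l"

lemma mem_semiorder_edges:
  "(i, j) \<in> semiorder_edges l \<longleftrightarrow> i \<in> {1..l} \<and> j \<in> {1..l} \<and> i \<noteq> j"
  by (auto simp: semiorder_edges_def)

lemma zero_notin_semiorder_edges: "(0, 0) \<notin> semiorder_edges l"
  by (simp add: mem_semiorder_edges)

lemma swap_semiorder_edges: "e \<in> semiorder_edges l \<Longrightarrow> prod.swap e \<in> semiorder_edges l"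
  by (cases e) (auto simp: mem_semiorder_edges)

lemma swap_semiorder_edge_neq: "e \<in> semiorder_edges l \<Longrightarrow> prod.swap e \<noteq> e"
  by (cases e) (auto simp: mem_semiorder_edges)

lemma card_semiorder_edges: "card (semiorder_edges l) = l * (l - 1)"
  by (simp add: semiorder_edges_def)

lemma Union_opposite_pairs: "\<Union>(opposite_pairs l) = semiorder_edges l"
  by (auto simp: opposite_pairs_def semiorder_edges_def)

lemma disjoint_opposite_pairs: "disjoint (opposite_pairs l)"
  by (auto simp: opposite_pairs_def disjoint_def)

lemma card_opposite_pair: "p \<in> opposite_pairs l \<Longrightarrow> card p = 2"
  by (auto simp: opposite_pairs_def mem_semiorder_edges)

lemma semiorder_form_at_zero: "e \<in> semiorder_labels l \<Longrightarrow> semiorder_form e 0 = - 1"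
  by (auto simp: semiorder_labels_def semiorder_edges_def semiorder_form_def)

lemma semiorder_form_at_endpoint:
  assumes "e \<in> semiorder_edges l"
  shows "semiorder_form e (fst e) = 1" and "semiorder_form e (snd e) = - 1"
  using assms by (cases e; simp add: mem_semiorder_edges semiorder_form_def)+

lemma semiorder_form_off_endpoints:
  "k \<noteq> 0 \<Longrightarrow> k \<notin> {fst e, snd e} \<Longrightarrow> semiorder_form e k = 0"
  by (auto simp: semiorder_form_def split_beta)

lemma semiorder_form_in_coord_space:
  "e \<in> semiorder_labels l \<Longrightarrow> semiorder_form e \<in> coord_space (l + 1)"
  by (auto simp: semiorder_labels_def semiorder_edges_def semiorder_form_def coord_space_def)

lemma semiorder_form_nonzero: "e \<in> semiorder_labels l \<Longrightarrow> semiorder_form e \<noteq> 0"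
  using semiorder_form_at_zero[of e l] by auto

lemma inj_on_semiorder_form: "inj_on semiorder_form (semiorder_labels l)"
proof (rule inj_onI)
  fix e e' assume labels: "e \<in> semiorder_labels l" "e' \<in> semiorder_labels l"
    and eq: "semiorder_form e = semiorder_form e'"
  obtain i j i' j' where e: "e = (i, j)" "e' = (i', j')" by fastforce
  have "semiorder_form e k = semiorder_form e' k" for k by (simp add: eq)
  from this[of i] this[of j] this[of i'] this[of j'] show "e = e'"
    using labels unfolding e semiorder_labels_def semiorder_edges_def semiorder_form_def
    by (auto split: if_splits simp: of_bool_def)
qed

lemma hyperplane_semiorder_form:
  assumes "(i, j) \<in> semiorder_labels l"
  shows "hyperplane (l + 1) (semiorder_form (i, j)) =
    {x \<in> coord_space (l + 1). x i - x j - x 0 = 0}"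
proof -
  have "(\<Sum>k<l + 1. semiorder_form (i, j) k * x k) = x i - x j - x 0" for x
  proof -
    have "(\<Sum>k<l + 1. semiorder_form (i, j) k * x k) = (\<Sum>k<l + 1. if k = i then x i else 0)
        - (\<Sum>k<l + 1. if k = j then x j else 0) - (\<Sum>k<l + 1. if k = 0 then x 0 else 0)"
      unfolding sum_subtractf[symmetric]
      by (rule sum.cong) (auto simp: semiorder_form_def algebra_simps)
    moreover have "i \<le> l" and "j \<le> l"
      using assms by (auto simp: semiorder_labels_def mem_semiorder_edges)
    ultimately show ?thesis by (simp add: less_Suc_eq_le del: sum.lessThan_Suc)
  qed
  then show ?thesis by (simp add: hyperplane_def)
qed

lemma semiorder_cone_eq_image:
  "semiorder_cone l = (\<lambda>e. hyperplane (l + 1) (semiorder_form e)) ` semiorder_labels l"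
proof -
  define h where "h = (\<lambda>(i, j). {x \<in> coord_space (l + 1). x i - x j - x 0 = 0})"
  have opposite: "{x \<in> coord_space (l + 1). x i - x j + x 0 = 0} = h (j, i)" for i j
    unfolding h_def by (auto simp: algebra_simps add_eq_0_iff)
  have infinity: "{x \<in> coord_space (l + 1). x 0 = 0} = h (0, 0)"
    by (auto simp: h_def)
  have "semiorder_cone l = {h (0, 0)} \<union> {h (j, i) |i j. 1 \<le> i \<and> i < j \<and> j \<le> l} \<union>
      {h (i, j) |i j. 1 \<le> i \<and> i < j \<and> j \<le> l}"
    unfolding semiorder_cone_def opposite infinity by (simp add: h_def)
  also have "\<dots> = h ` ({(0, 0)} \<union> {(j, i) |i j. 1 \<le> i \<and> i < j \<and> j \<le> l} \<union>
      {(i, j) |i j. 1 \<le> i \<and> i < j \<and> j \<le> l})"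
    unfolding image_Un by (intro arg_cong2[of _ _ _ _ "(\<union>)"]) blast+
  also have "{(0, 0)} \<union> {(j, i) |i j. 1 \<le> i \<and> i < j \<and> j \<le> l} \<union>
      {(i, j) |i j. 1 \<le> i \<and> i < j \<and> j \<le> l} = semiorder_labels l"
    by (auto simp: semiorder_labels_def semiorder_edges_def)
  also have "h ` semiorder_labels l =
      (\<lambda>e. hyperplane (l + 1) (semiorder_form e)) ` semiorder_labels l"
  proof (rule image_cong[OF refl])
    fix e assume "e \<in> semiorder_labels l"
    then show "h e = hyperplane (l + 1) (semiorder_form e)"
      using hyperplane_semiorder_form[of "fst e" "snd e" l] by (simp add: h_def split_beta)
  qed
  finally show ?thesis .
qed

lemma bij_betw_semiorder_cone:
  "bij_betw (\<lambda>e. hyperplane (l + 1) (semiorder_form e)) (semiorder_labels l) (semiorder_cone l)"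
proof (rule bij_betw_imageI[OF inj_onI semiorder_cone_eq_image[symmetric]])
  fix e e' assume labels: "e \<in> semiorder_labels l" "e' \<in> semiorder_labels l"
    and "hyperplane (l + 1) (semiorder_form e) = hyperplane (l + 1) (semiorder_form e')"
  then obtain c where c: "semiorder_form e = cscale c (semiorder_form e')"
    using hyperplane_eq_imp_proportional semiorder_form_in_coord_space semiorder_form_nonzero
    by metis
  then have "c = 1"
    using fun_cong[OF c, of 0] labels[THEN semiorder_form_at_zero]
    by (simp add: cscale_def)
  then show "e = e'"
    using c labels inj_on_semiorder_form by (auto dest: inj_onD)
qed

locale semiorder_relation =
  fixes l :: nat and T :: "(nat \<times> nat) set" and v :: "nat \<times> nat \<Rightarrow> complex"
  assumes labels: "T \<subseteq> semiorder_labels l"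
    and finite_support: "finite T"
    and nonzero: "e \<in> T \<Longrightarrow> v e \<noteq> 0"
    and relation: "(\<Sum>e\<in>T. cscale (v e) (semiorder_form e)) = 0"
begin

lemma relation_at: "(\<Sum>e\<in>T. v e * semiorder_form e k) = 0"
  using fun_cong[OF relation, of k] by (simp add: sum_cscale_apply)

lemma sum_coefficients_eq_zero: "(\<Sum>e\<in>T. v e) = 0"
proof -
  have "(\<Sum>e\<in>T. v e * semiorder_form e 0) = - (\<Sum>e\<in>T. v e)"
    unfolding sum_negf[symmetric]
    using labels by (intro sum.cong) (auto simp: semiorder_form_at_zero)
  then show ?thesis using relation_at[of 0] by simp
qed

lemma semiorder_form_at_endpoint_sign:
  assumes "e \<in> T" and "k \<in> {fst e, snd e}" and "k \<noteq> 0"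
  shows "semiorder_form e k \<in> {1, - 1}"
proof -
  have "e \<in> semiorder_edges l" using assms labels by (auto simp: semiorder_labels_def)
  from semiorder_form_at_endpoint[OF this] show ?thesis using assms(2) by auto
qed

lemma ex_other_at_endpoint:
  assumes e: "e \<in> T" and k: "k \<in> {fst e, snd e}" "k \<noteq> 0"
  obtains e' where "e' \<in> T" and "e' \<noteq> e" and "k \<in> {fst e', snd e'}"
proof -
  have "\<exists>e'\<in>T - {e}. k \<in> {fst e', snd e'}"
  proof (rule ccontr)
    assume "\<not> ?thesis"
    then have "(\<Sum>e'\<in>T - {e}. v e' * semiorder_form e' k) = 0"
      using k(2) by (intro sum.neutral) (auto simp: semiorder_form_off_endpoints)
    then have "v e * semiorder_form e k = 0"
      using relation_at[of k] sum.remove[OF finite_support e, of "\<lambda>e. v e * semiorder_form e k"]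
      by simp
    then show False
      using semiorder_form_at_endpoint_sign[OF e k] nonzero[OF e] by auto
  qed
  with that show thesis by blast
qed

text \<open>If \<open>prod.swap e\<close> is absent, the other two forms each share one endpoint with \<open>e\<close>, so all three
  coefficients agree up to sign; then their sum, an odd multiple of \<open>v e\<close>, is not zero.\<close>

lemma swap_in_support:
  assumes "card T \<le> 3" and e: "e \<in> T" "e \<in> semiorder_edges l"
  shows "prod.swap e \<in> T"
proof (rule ccontr)
  assume no_swap: "prod.swap e \<notin> T"
  define i j where "i = fst e" and "j = snd e"
  have i: "i \<noteq> 0" and j: "j \<noteq> 0" and "i \<noteq> j"
    using e(2) by (auto simp: i_def j_def semiorder_edges_def)
  obtain f where f: "f \<in> T" "f \<noteq> e" "i \<in> {fst f, snd f}"
    using ex_other_at_endpoint[OF e(1) _ i] by (auto simp: i_def)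
  obtain g where g: "g \<in> T" "g \<noteq> e" "j \<in> {fst g, snd g}"
    using ex_other_at_endpoint[OF e(1) _ j] by (auto simp: j_def)
  have "f \<noteq> prod.swap e" and "g \<noteq> prod.swap e"
    using f(1) g(1) no_swap by auto
  then have f_off: "j \<notin> {fst f, snd f}" and g_off: "i \<notin> {fst g, snd g}"
    using f(2,3) g(2,3) \<open>i \<noteq> j\<close> unfolding i_def j_def
    by (cases e; cases f; cases g; auto)+
  then have "f \<noteq> g" using g(3) by auto
  have "T = {e, f, g}"
    using card_seteq[OF finite_support, of "{e, f, g}"] assms f g \<open>f \<noteq> g\<close> by simp
  then have sum_T: "(\<Sum>x\<in>T. F x) = F e + F f + F g" for F :: "nat \<times> nat \<Rightarrow> complex"
    using f(2) g(2) \<open>f \<noteq> g\<close> by (simp add: add.assoc)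
  have at_i: "v e + v f * semiorder_form f i = 0" and at_j: "v e = v g * semiorder_form g j"
    using relation_at[of i] relation_at[of j] semiorder_form_at_endpoint[OF e(2)]
      semiorder_form_off_endpoints[OF i g_off] semiorder_form_off_endpoints[OF j f_off]
    by (simp_all add: sum_T i_def j_def)
  have "v f \<in> {v e, - v e}"
    using at_i semiorder_form_at_endpoint_sign[OF f(1,3) i] by (auto simp: add_eq_0_iff2)
  moreover have "v g \<in> {v e, - v e}"
    using at_j semiorder_form_at_endpoint_sign[OF g(1,3) j] by auto
  moreover have "v e + v f + v g = 0"
    using sum_coefficients_eq_zero by (simp add: sum_T)
  ultimately have "v e = 0" by auto
  with nonzero[OF e(1)] show False ..
qed

lemma edges_in_support_eq:
  assumes "card T \<le> 3" and e: "e \<in> T" "e \<in> semiorder_edges l"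
  shows "T - {(0, 0)} = {e, prod.swap e}"
proof -
  let ?e' = "prod.swap e"
  have e': "?e' \<in> T" "?e' \<noteq> e"
    using swap_in_support[OF assms] swap_semiorder_edge_neq[OF e(2)] by auto
  have "f \<in> {e, ?e'}" if f: "f \<in> T" "f \<in> semiorder_edges l" for f
  proof (rule ccontr)
    assume other: "f \<notin> {e, ?e'}"
    have "card {e, ?e', f, prod.swap f} = 4"
      using other e'(2) swap_semiorder_edge_neq[OF f(2)]
      by (auto simp: card_insert_if inj_eq[OF inj_swap])
    moreover have "{e, ?e', f, prod.swap f} \<subseteq> T"
      using e e' f swap_in_support[OF assms(1) f] by simp
    ultimately show False
      using card_mono[OF finite_support, of "{e, ?e', f, prod.swap f}"] assms(1) by simp
  qed
  then show ?thesis
    using e e' labels zero_notin_semiorder_edges[of l] swap_semiorder_edges[OF e(2)]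
    by (auto simp: semiorder_labels_def)
qed

lemma support_in_opposite_triples:
  assumes "card T \<le> 3" and "T \<noteq> {}"
  shows "T \<in> insert (0, 0) ` opposite_pairs l"
proof -
  have "T \<noteq> {(0, 0)}"
    using sum_coefficients_eq_zero nonzero by auto
  then obtain e where e: "e \<in> T" "e \<in> semiorder_edges l"
    using labels \<open>T \<noteq> {}\<close> by (auto simp: semiorder_labels_def)
  let ?e' = "prod.swap e"
  have edges: "T - {(0, 0)} = {e, ?e'}"
    using assms(1) e by (rule edges_in_support_eq)
  have "(0, 0) \<in> T"
  proof (rule ccontr)
    assume "(0, 0) \<notin> T"
    then have T: "T = {e, ?e'}" using edges by simp
    have neq: "?e' \<noteq> e" using e(2) by (rule swap_semiorder_edge_neq)
    have "v e - v ?e' = 0"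
      using relation_at[of "fst e"] neq semiorder_form_at_endpoint(1)[OF e(2)]
        semiorder_form_at_endpoint(2)[OF swap_semiorder_edges[OF e(2)]]
      by (simp add: T)
    moreover have "v e + v ?e' = 0"
      using sum_coefficients_eq_zero neq by (simp add: T)
    ultimately show False using nonzero[OF e(1)] by (simp add: add_eq_0_iff2)
  qed
  then have "T = insert (0, 0) {e, ?e'}" using edges by blast
  then show ?thesis using e(2) by (auto simp: opposite_pairs_def)
qed

end

lemma dependent_semiorder_forms_opposite_pair:
  assumes e: "e \<in> semiorder_edges l"
  shows "cfun.dependent (semiorder_form ` {(0, 0), e, prod.swap e})"
proof -
  have labels: "(0, 0) \<in> semiorder_labels l" "e \<in> semiorder_labels l"
      "prod.swap e \<in> semiorder_labels l"
    using e swap_semiorder_edges[OF e] by (auto simp: semiorder_labels_def)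
  have "semiorder_form (0, 0) =
      cscale (1 / 2) (semiorder_form e + semiorder_form (prod.swap e))"
    by (auto simp: semiorder_form_def cscale_def split_beta)
  also have "\<dots> \<in> cfun.span (semiorder_form ` {e, prod.swap e})"
    by (intro cfun.span_scale cfun.span_add cfun.span_base) auto
  also have "semiorder_form ` {e, prod.swap e} =
      semiorder_form ` {(0, 0), e, prod.swap e} - {semiorder_form (0, 0)}"
    using labels inj_on_semiorder_form[of l] zero_notin_semiorder_edges[of l]
      e swap_semiorder_edges[OF e]
    by (auto dest: inj_onD)
  finally show ?thesis unfolding cfun.dependent_def by blast
qed

theorem dependent_semiorder_forms_iff:
  assumes T: "T \<subseteq> semiorder_labels l" "card T \<le> 3"
  shows "cfun.dependent (semiorder_form ` T) \<longleftrightarrow> T \<in> insert (0, 0) ` opposite_pairs l"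
proof
  assume "T \<in> insert (0, 0) ` opposite_pairs l"
  then show "cfun.dependent (semiorder_form ` T)"
    using dependent_semiorder_forms_opposite_pair by (auto simp: opposite_pairs_def)
next
  have "finite (semiorder_labels l)" by (simp add: semiorder_labels_def semiorder_edges_def)
  then have "finite T" using T(1) by (rule rev_finite_subset)
  assume "cfun.dependent (semiorder_form ` T)"
  then obtain u where u: "\<exists>e\<in>T. u e \<noteq> 0" "(\<Sum>e\<in>T. cscale (u e) (semiorder_form e)) = 0"
    using dependent_image_iff[OF \<open>finite T\<close> inj_on_subset[OF inj_on_semiorder_form T(1)]] by blast
  define R where "R = {e \<in> T. u e \<noteq> 0}"
  have R: "R \<subseteq> T" "R \<noteq> {}" using u(1) by (auto simp: R_def)
  have "card R \<le> 3" using card_mono[OF \<open>finite T\<close> R(1)] T(2) by simp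
  interpret semiorder_relation l R u
  proof
    show "(\<Sum>e\<in>R. cscale (u e) (semiorder_form e)) = 0"
      using u(2) \<open>finite T\<close>
      by (subst sum.mono_neutral_left[of T]) (auto simp: R_def)
  qed (use T(1) \<open>finite T\<close> in \<open>auto simp: R_def\<close>)
  have R_triple: "R \<in> insert (0, 0) ` opposite_pairs l"
    using \<open>card R \<le> 3\<close> R(2) by (rule support_in_opposite_triples)
  then obtain p where p: "p \<in> opposite_pairs l" "R = insert (0, 0) p" by blast
  then have "card R = 3"
    using card_opposite_pair[OF p(1)] zero_notin_semiorder_edges[of l] Union_opposite_pairs[of l]
    by (subst p(2), subst card_insert_disjoint) (auto intro: card_ge_0_finite)
  then have "R = T" using card_seteq[OF \<open>finite T\<close> R(1)] T(2) by simp
  with R_triple show "T \<in> insert (0, 0) ` opposite_pairs l" by simp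
qed

theorem theorem6p4:
  fixes l n :: nat and \<alpha> :: "nat \<Rightarrow> nat \<Rightarrow> complex"
  assumes "l \<ge> 1"
    and "defining_forms (l + 1) n \<alpha> (semiorder_cone l)"
  shows "falk_invariant n \<alpha> = l * (l - 1)"
proof -
  have "falk_invariant n \<alpha> = card (\<Union>(opposite_pairs l))"
  proof (rule falk_invariant_labelled_disjoint_pairs[OF assms(2) _ bij_betw_semiorder_cone])
    show "semiorder_form e \<in> coord_space (l + 1) \<and> semiorder_form e \<noteq> 0"
      if "e \<in> semiorder_labels l" for e
      using that semiorder_form_in_coord_space semiorder_form_nonzero by blast
    show "(0, 0) \<in> semiorder_labels l" by (simp add: semiorder_labels_def)
    show "\<Union>(opposite_pairs l) \<subseteq> semiorder_labels l - {(0, 0)}"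
      using zero_notin_semiorder_edges by (auto simp: Union_opposite_pairs semiorder_labels_def)
  qed (fact disjoint_opposite_pairs card_opposite_pair dependent_semiorder_forms_iff)+
  also have "\<dots> = l * (l - 1)"
    by (simp add: Union_opposite_pairs card_semiorder_edges)
  finally show ?thesis .
qed

end
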